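(* For every $a\in\mathbb{C}$ with $a+\tfrac12\notin\{0,-1,-2,\dots\}$, $$F\!\left(a,1-a;a+\tfrac12;\tfrac12-\tfrac12\sqrt2\right)=\frac{2^{3/4-2a}\,(\sqrt2-1)^{1/2-a}\sqrt{\pi}\;\Gamma(a+\tfrac12)}{\Gamma(\tfrac12a+\tfrac38)\,\Gamma(\tfrac12a+\tfrac58)}.$$
   Context: $F(a,b;c;x)=\sum_{n\ge0}\frac{(a,n)(b,n)}{(c,n)(1,n)}x^n$ with $(\alpha,n)=\Gamma(\alpha+n)/\Gamma(\alpha)$ is the Gauss hypergeometric series. For $t>0$ and $s\in\mathbb{C}$, $t^s=e^{s\log t}$ with real logarithm. $1/\Gamma$ is interpreted as $0$ at the poles of $\Gamma$. *)

theory Defs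
  imports "HOL-Analysis.Analysis" "HOL-Computational_Algebra.Computational_Algebra"
begin

(* The Pochhammer symbol, rather than a quotient of Gamma values, is used for (alpha,n), so that
   the series also makes sense (and terminates) when a or b is a non-positive integer.
   c is meant to avoid the non-positive integers. *)
definition hypergeo_term :: "complex \<Rightarrow> complex \<Rightarrow> complex \<Rightarrow> complex \<Rightarrow> nat \<Rightarrow> complex" where
  "hypergeo_term a b c x n =
     (pochhammer a n * pochhammer b n) / (pochhammer c n * pochhammer 1 n) * x ^ n"

definition hypergeo_F :: "complex \<Rightarrow> complex \<Rightarrow> complex \<Rightarrow> complex \<Rightarrow> complex" where
  "hypergeo_F a b c x = (\<Sum>n. hypergeo_term a b c x n)"

lemma pochhammer_eq_Gamma_quotient:
  fixes z :: complex
  assumes "z \<notin> \<int>\<^sub>\<le>\<^sub>0"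
  shows "pochhammer z n = Gamma (z + of_nat n) / Gamma z"
  using pochhammer_Gamma[OF assms] .

lemma hypergeo_F_eq_eval_fps_hypergeo:
  "hypergeo_F a b c x = eval_fps (fps_hypergeo [a, b] [c] 1) x"
  by (simp add: hypergeo_F_def hypergeo_term_def eval_fps_def flip: pochhammer_fact)

lemma hypergeo_term_Suc:
  "hypergeo_term a b c x (Suc n) =
     ((a + of_nat n) * (b + of_nat n) / ((c + of_nat n) * (1 + of_nat n)) * x) *
     hypergeo_term a b c x n"
  by (simp add: hypergeo_term_def pochhammer_Suc mult_ac)

lemma summable_hypergeo_term:
  assumes "norm x < 1"
  shows "summable (hypergeo_term a b c x)"
proof -
  define q where
    "q n = (a + of_nat n) * (b + of_nat n) / ((c + of_nat n) * (1 + of_nat n)) * x" for n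
  have lim1: "(\<lambda>n. z / of_nat n + 1) \<longlonglongrightarrow> 1" for z :: complex
    using tendsto_add[OF lim_const_over_n[of z] tendsto_const[of 1]] by simp
  have "(\<lambda>n. (a / of_nat n + 1) * (b / of_nat n + 1) /
          ((c / of_nat n + 1) * (1 / of_nat n + 1)) * x) \<longlonglongrightarrow> 1 * 1 / (1 * 1) * x"
    by (intro tendsto_intros lim1) auto
  moreover have "eventually (\<lambda>n. (a / of_nat n + 1) * (b / of_nat n + 1) /
          ((c / of_nat n + 1) * (1 / of_nat n + 1)) * x = q n) sequentially"
    using eventually_gt_at_top[of 0]
  proof eventually_elim
    case (elim n)
    have "z / of_nat n + 1 = (z + of_nat n) / of_nat n" for z :: complex
      using elim by (simp add: add_divide_distrib)
    then show ?case using elim by (simp add: q_def)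
  qed
  ultimately have "q \<longlonglongrightarrow> x"
    using tendsto_cong by force
  then have "(\<lambda>n. norm (q n)) \<longlonglongrightarrow> norm x"
    by (rule tendsto_norm)
  moreover obtain r where r: "norm x < r" "r < 1"
    using assms dense by blast
  ultimately have "eventually (\<lambda>n. norm (q n) < r) sequentially"
    by (intro order_tendstoD)
  then obtain N where N: "\<And>n. n \<ge> N \<Longrightarrow> norm (q n) < r"
    by (auto simp: eventually_sequentially)
  show ?thesis
  proof (rule summable_ratio_test[OF r(2)])
    fix n assume "n \<ge> N"
    then show "norm (hypergeo_term a b c x (Suc n)) \<le> r * norm (hypergeo_term a b c x n)"
      using N[of n] unfolding hypergeo_term_Suc q_def[symmetric] norm_mult
      by (intro mult_right_mono) auto
  qed
qed

end

theory Submission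
  imports Defs
begin

text \<open>
  Put \<open>x = (1 - \<surd>2) / 2\<close> and \<open>w = x / (x - 1) = 3 - 2 \<surd>2\<close>. Pfaff's transformation
  (\<open>pfaff_transformation\<close>) turns the left-hand side into \<open>(1 - x) powr (a - 1)\<close> times
  \<open>\<phi> a = F (1/2) (1 - a) (a + 1/2) w\<close>. This form has two advantages.

  For this particular \<open>w\<close>, the contiguous relation for the step \<open>a \<rightarrow> a + 2\<close>, which in general
  has three terms, degenerates to the two-term relation
  \<open>(4 a + 3) (4 a + 5) \<phi> (a + 2) = 4 (2 a + 1) (2 a + 3) \<phi> a\<close>
  (\<open>contiguous_relation\<close>); it is proved by creative telescoping. Moreover, \<open>\<phi> (a + 2 n)\<close> has a
  simple limit as \<open>n\<close> grows: the parameters \<open>1 - a\<close> and \<open>a + 1/2\<close> cancel up to sign, and the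
  binomial series \<open>(1 + w) powr (-1/2)\<close> remains (\<open>hypergeo_F_tendsto_binomial\<close>).

  Iterating the relation expresses \<open>\<phi> a\<close> by quotients of Pochhammer symbols times
  \<open>\<phi> (a + 2 n)\<close>, and those quotients converge to quotients of Gamma values by Euler's limit
  formula (\<open>hypergeo_F_half_value\<close>). Legendre's duplication formula combines the two Gamma
  factors in the numerator into \<open>Gamma (a + 1/2)\<close>.
\<close>

section \<open>Absolute convergence and the binomial series\<close>

text \<open>
  A power series converges absolutely strictly inside any disc in which it converges.
\<close>
lemma norm_summable_hypergeo_term:
  assumes "norm x < 1"
  shows "summable (\<lambda>n. norm (hypergeo_term a b c x n))"
proof -
  obtain r where r: "norm x < r" "r < 1"
    using assms dense by blast
  then have r0: "0 < r"
    using norm_ge_zero[of x] by linarith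
  have "summable (\<lambda>n. pochhammer a n * pochhammer b n / (pochhammer c n * pochhammer 1 n)
                       * of_real r ^ n)"
    using summable_hypergeo_term[of "of_real r" a b c] r r0 by (simp add: hypergeo_term_def[abs_def])
  from powser_insidea[OF this, of x] show ?thesis
    using r r0 by (simp add: hypergeo_term_def)
qed

text \<open>
  The terms at a slightly larger radius still tend to \<open>0\<close>, and the geometric factor gained in
  passing to that radius beats the linear one.
\<close>
lemma hypergeo_term_times_n_tendsto_0:
  assumes "norm x < 1"
  shows "(\<lambda>n. of_nat n * hypergeo_term a b c x n) \<longlonglongrightarrow> 0"
proof -
  obtain r where r: "norm x < r" "r < 1"
    using assms dense by blast
  then have r0: "0 < r"
    using norm_ge_zero[of x] by linarith
  have "(\<lambda>n. of_nat n * (x / of_real r) ^ n) \<longlonglongrightarrow> 0"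
    using r r0 by (intro powser_times_n_limit_0) (simp add: norm_divide)
  moreover have "hypergeo_term a b c (of_real r) \<longlonglongrightarrow> 0"
    using r r0 by (intro summable_LIMSEQ_zero summable_hypergeo_term) simp
  ultimately have "(\<lambda>n. of_nat n * (x / of_real r) ^ n * hypergeo_term a b c (of_real r) n) \<longlonglongrightarrow> 0 * 0"
    by (rule tendsto_mult)
  moreover have "of_nat n * (x / of_real r) ^ n * hypergeo_term a b c (of_real r) n =
      of_nat n * hypergeo_term a b c x n" for n
    using r0 by (simp add: hypergeo_term_def power_divide)
  ultimately show ?thesis by simp
qed

lemma binomial_series_pochhammer:
  fixes b x :: complex
  assumes "norm x < 1"
  shows "((\<lambda>m. pochhammer b m / fact m * x ^ m) has_sum (1 - x) powr (-b)) UNIV"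
proof (rule norm_summable_imp_has_sum)
  have *: "hypergeo_term b 1 1 x m = pochhammer b m / fact m * x ^ m" for m
    by (simp add: hypergeo_term_def pochhammer_fact[symmetric])
  show "summable (\<lambda>m. norm (pochhammer b m / fact m * x ^ m))"
    using norm_summable_hypergeo_term[OF assms, of b 1 1] by (simp add: *)
  have "(-1) ^ n * ((-1) ^ n * z) = z" for n and z :: complex
    by (simp flip: power_mult_distrib mult.assoc)
  then show "(\<lambda>m. pochhammer b m / fact m * x ^ m) sums (1 - x) powr (-b)"
    using gen_binomial_complex[of "-x" "-b"] assms
    by (simp add: gbinomial_pochhammer power_minus[of x] mult_ac)
qed

lemma binomial_series_pochhammer_real:
  fixes b x :: real
  assumes "0 \<le> b" "0 \<le> x" "x < 1"
  shows "((\<lambda>m. pochhammer b m / fact m * x ^ m) has_sum (1 - x) powr (-b)) UNIV"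
proof -
  have "((\<lambda>m. complex_of_real (pochhammer b m / fact m * x ^ m)) has_sum
          of_real ((1 - x) powr (-b))) UNIV"
    using binomial_series_pochhammer[of "of_real x" "of_real b"] assms
    by (simp add: pochhammer_of_real powr_of_real[symmetric])
  then show ?thesis
    by (simp only: has_sum_of_real_iff)
qed

section \<open>Pfaff's transformation\<close>

text \<open>
  Pascal's rule splits the sum for \<open>n + 1\<close> into the sum for \<open>n\<close> and \<open>d / c\<close> times the same sum
  with both parameters raised by one.
\<close>
lemma chu_vandermonde:
  fixes c d :: complex
  assumes "c \<notin> \<int>\<^sub>\<le>\<^sub>0"
  shows "(\<Sum>k\<le>n. (-1) ^ k * of_nat (n choose k) * (pochhammer d k / pochhammer c k)) =
           pochhammer (c - d) n / pochhammer c n"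
  using assms
proof (induction n arbitrary: c d)
  case 0
  then show ?case by simp
next
  case (Suc n)
  define f where "f k = pochhammer d k / pochhammer c k" for k
  have c1: "c + 1 \<notin> \<int>\<^sub>\<le>\<^sub>0"
    using Suc.prems plus_one_in_nonpos_Ints_imp by blast
  have pc: "pochhammer c m \<noteq> 0" for m
    using Suc.prems pochhammer_eq_0_imp_nonpos_Int by blast
  have cn: "c + of_nat n \<noteq> 0"
    using pc[of "Suc n"] by (simp add: pochhammer_Suc)
  have shift: "f (Suc k) = d / c * (pochhammer (d + 1) k / pochhammer (c + 1) k)" for k
    by (simp add: f_def pochhammer_rec)
  have "(\<Sum>k\<le>Suc n. (-1) ^ k * of_nat (Suc n choose k) * f k) =
        f 0 + (\<Sum>k\<le>n. (-1) ^ Suc k * of_nat (Suc n choose Suc k) * f (Suc k))"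
    by (subst sum.atMost_Suc_shift) simp
  also have "\<dots> = f 0 + (\<Sum>k\<le>n. (-1) ^ Suc k * of_nat (n choose Suc k) * f (Suc k))
                 - (\<Sum>k\<le>n. (-1) ^ k * of_nat (n choose k) * f (Suc k))"
    by (simp add: sum.distrib[symmetric] sum_subtractf[symmetric] algebra_simps)
  also have "f 0 + (\<Sum>k\<le>n. (-1) ^ Suc k * of_nat (n choose Suc k) * f (Suc k)) =
             (\<Sum>k\<le>Suc n. (-1) ^ k * of_nat (n choose k) * f k)"
    by (subst sum.atMost_Suc_shift) simp
  also have "\<dots> = (\<Sum>k\<le>n. (-1) ^ k * of_nat (n choose k) * f k)"
    by simp
  also have "\<dots> = pochhammer (c - d) n / pochhammer c n"
    unfolding f_def by (rule Suc.IH[OF Suc.prems])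
  also have "(\<Sum>k\<le>n. (-1) ^ k * of_nat (n choose k) * f (Suc k)) =
             d / c * (\<Sum>k\<le>n. (-1) ^ k * of_nat (n choose k)
                             * (pochhammer (d + 1) k / pochhammer (c + 1) k))"
    unfolding shift sum_distrib_left by (intro sum.cong) auto
  also have "\<dots> = d / c * (pochhammer (c - d) n / pochhammer (c + 1) n)"
    by (subst Suc.IH[OF c1]) simp
  also have "d / c * (pochhammer (c - d) n / pochhammer (c + 1) n) =
             d * pochhammer (c - d) n / (pochhammer c n * (c + of_nat n))"
    by (simp add: pochhammer_rec[symmetric]) (simp add: pochhammer_Suc)
  also have "pochhammer (c - d) n / pochhammer c n -
             d * pochhammer (c - d) n / (pochhammer c n * (c + of_nat n)) =
             pochhammer (c - d) (Suc n) / pochhammer c (Suc n)"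
    using pc[of n] cn by (simp add: pochhammer_Suc divide_simps) (simp add: algebra_simps)
  finally show ?case unfolding f_def .
qed

lemma norm_pochhammer_le:
  fixes b :: complex
  shows "norm (pochhammer b n) \<le> pochhammer (norm b) n"
proof (induction n)
  case (Suc n)
  have "norm (b + of_nat n) \<le> norm b + of_nat n"
    using norm_triangle_ineq[of b "of_nat n"] by simp
  with Suc show ?case
    unfolding pochhammer_Suc norm_mult
    by (intro mult_mono order_trans[OF norm_ge_zero Suc.IH]) auto
qed simp

text \<open>
  Both sides are sums of one double series \<open>T\<close>: expanding \<open>(1 - x) powr (-b - k)\<close> in the
  \<open>k\<close>-th term on the right gives its rows, and along the diagonals \<open>k + m = n\<close> the
  Chu--Vandermonde sum collapses it to the \<open>n\<close>-th term on the left. The bound \<open>norm x < 1/2\<close>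
  is what makes \<open>T\<close> absolutely summable: the row sums of the majorant \<open>M\<close> are,
  up to a constant, the absolute values of the terms of a hypergeometric series at
  \<open>norm x / (1 - norm x)\<close>.
\<close>
lemma pfaff_transformation:
  assumes x: "norm x < 1/2" and c: "c \<notin> \<int>\<^sub>\<le>\<^sub>0"
  shows "hypergeo_F a b c x = (1 - x) powr (-b) * hypergeo_F (c - a) b c (x / (x - 1))"
proof -
  define q where "q k = pochhammer (c - a) k / (pochhammer c k * fact k)" for k
  define T where "T = (\<lambda>(k, m). q k * (-1) ^ k * (pochhammer b (k + m) / fact m) * x ^ (k + m))"
  define \<beta> where "\<beta> = norm b"
  define r where "r = norm x"
  have r: "0 \<le> r" "r < 1" "r / (1 - r) < 1" and \<beta>: "0 \<le> \<beta>"
    using x by (auto simp: r_def \<beta>_def field_simps)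
  have x1: "1 - x \<noteq> 0"
    using x by auto
  have nonneg: "0 \<le> pochhammer \<beta> n" for n
    using \<beta> by (simp add: pochhammer_prod prod_nonneg)
  \<comment> \<open>The majorant replaces \<open>b\<close> by its norm, so that its row sums are again explicit.\<close>
  define M where "M = (\<lambda>(k, m). norm (q k) * (pochhammer \<beta> (k + m) / fact m) * r ^ (k + m))"
  have "M summable_on Sigma UNIV (\<lambda>_. UNIV)"
  proof (rule summable_on_SigmaI)
    fix k
    have "((\<lambda>m. norm (q k) * pochhammer \<beta> k * r ^ k * (pochhammer (\<beta> + of_nat k) m / fact m * r ^ m))
        has_sum norm (q k) * pochhammer \<beta> k * r ^ k * (1 - r) powr (-(\<beta> + of_nat k))) UNIV"
      using r \<beta> by (intro has_sum_cmult_right binomial_series_pochhammer_real) auto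
    then show "((\<lambda>m. M (k, m)) has_sum
        norm (q k) * pochhammer \<beta> k * r ^ k * (1 - r) powr (-(\<beta> + of_nat k))) UNIV"
      by (simp add: M_def pochhammer_product' power_add mult_ac)
  next
    have "(\<lambda>k. norm (q k) * pochhammer \<beta> k * r ^ k * (1 - r) powr (-(\<beta> + of_nat k))) =
          (\<lambda>k. (1 - r) powr (-\<beta>) *
               norm (hypergeo_term (c - a) (of_real \<beta>) c (of_real (r / (1 - r))) k))"
      using r \<beta> norm_of_real[of "1 - r", where ?'a = complex]
      by (simp add: fun_eq_iff q_def hypergeo_term_def powr_diff powr_realpow pochhammer_of_real
            pochhammer_fact[symmetric] norm_mult norm_divide norm_power power_divide
            nonneg)
    moreover have "\<dots> summable_on UNIV"
    proof (intro summable_on_cmult_right norm_summable_imp_summable_on)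
      have "norm (complex_of_real (r / (1 - r))) < 1"
        using r by (subst norm_of_real) simp
      from norm_summable_hypergeo_term[OF this]
      show "summable (\<lambda>k. norm (norm (hypergeo_term (c - a) (of_real \<beta>) c
              (of_real (r / (1 - r))) k)))"
        by simp
    qed
    ultimately show "(\<lambda>k. norm (q k) * pochhammer \<beta> k * r ^ k * (1 - r) powr (-(\<beta> + of_nat k)))
        summable_on UNIV" by simp
  next
    fix k m
    show "0 \<le> M (k, m)"
      using r nonneg by (simp add: M_def)
  qed
  moreover have "norm (T p) \<le> M p" for p
  proof (cases p)
    case (Pair k m)
    have "norm (pochhammer b (k + m)) \<le> pochhammer \<beta> (k + m)"
      unfolding \<beta>_def by (rule norm_pochhammer_le)
    then have "norm (q k) * (norm (pochhammer b (k + m)) / fact m) * r ^ (k + m) \<le>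
               norm (q k) * (pochhammer \<beta> (k + m) / fact m) * r ^ (k + m)"
      by (intro mult_right_mono mult_left_mono divide_right_mono zero_le_power r(1)) simp_all
    then show ?thesis
      by (simp add: Pair T_def M_def norm_mult norm_divide norm_power r_def)
  qed
  ultimately have "(\<lambda>p. norm (T p)) summable_on UNIV \<times> UNIV"
    by (rule summable_on_comparison_test) simp_all
  then have "T summable_on UNIV \<times> UNIV"
    by (rule abs_summable_summable)
  then obtain S where S: "(T has_sum S) (UNIV \<times> UNIV)"
    by (auto simp: summable_on_def)
  have row: "((\<lambda>m. T (k, m)) has_sum
       (1 - x) powr (-b) * hypergeo_term (c - a) b c (x / (x - 1)) k) UNIV" for k
  proof -
    have "((\<lambda>m. q k * pochhammer b k * (-x) ^ k * (pochhammer (b + of_nat k) m / fact m * x ^ m))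
        has_sum q k * pochhammer b k * (-x) ^ k * (1 - x) powr (-(b + of_nat k))) UNIV"
      using x by (intro has_sum_cmult_right binomial_series_pochhammer) auto
    moreover have "(1 - x) powr (-(b + of_nat k)) = (1 - x) powr (-b) / (1 - x) ^ k"
      using x1 by (simp add: powr_diff powr_nat')
    moreover have "(x / (x - 1)) ^ k = (-x) ^ k / (1 - x) ^ k"
      by (metis minus_diff_eq minus_divide_divide minus_minus power_divide)
    ultimately show ?thesis
      by (simp add: T_def q_def hypergeo_term_def pochhammer_product' power_add mult_ac
            power_minus[of x] pochhammer_fact[symmetric])
  qed
  have "((\<lambda>k. (1 - x) powr (-b) * hypergeo_term (c - a) b c (x / (x - 1)) k) has_sum S) UNIV"
    by (rule has_sum_SigmaD[OF S row])
  then have 1: "(\<Sum>k. (1 - x) powr (-b) * hypergeo_term (c - a) b c (x / (x - 1)) k) = S"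
    by (intro sums_unique[symmetric] has_sum_imp_sums)
  have "norm x < norm (x - 1)"
    using x norm_triangle_ineq2[of 1 x] by (simp add: norm_minus_commute)
  moreover have "0 < norm (x - 1)"
    using x1 by simp
  ultimately have "norm (x / (x - 1)) < 1"
    by (simp add: norm_divide)
  then have 2: "S = (1 - x) powr (-b) * hypergeo_F (c - a) b c (x / (x - 1))"
    unfolding 1[symmetric] hypergeo_F_def
    by (intro suminf_mult summable_hypergeo_term)
  have "((\<lambda>(n, k). T (k, n - k)) has_sum S) (SIGMA n:UNIV. {..n})"
    using S by (subst has_sum_reindex_bij_witness[where T = "UNIV \<times> UNIV" and h = T and
          j = "\<lambda>(n, k). (k, n - k)" and i = "\<lambda>(k, m). (k + m, k)"]) auto
  moreover have "((\<lambda>k. (case (n, k) of (n, k) \<Rightarrow> T (k, n - k))) has_sum hypergeo_term a b c x n) {..n}" for n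
  proof -
    have "(\<Sum>k\<le>n. T (k, n - k)) = pochhammer b n / fact n * x ^ n *
       (\<Sum>k\<le>n. (-1) ^ k * of_nat (n choose k) * (pochhammer (c - a) k / pochhammer c k))"
      unfolding sum_distrib_left
      by (intro sum.cong refl) (simp add: T_def q_def binomial_fact mult_ac)
    also have "\<dots> = hypergeo_term a b c x n"
      unfolding chu_vandermonde[OF c]
      by (simp add: hypergeo_term_def pochhammer_fact[symmetric] mult_ac)
    finally show ?thesis
      by (simp add: has_sum_finite_iff)
  qed
  ultimately have "(hypergeo_term a b c x has_sum S) UNIV"
    by (rule has_sum_SigmaD)
  then have "hypergeo_F a b c x = S"
    unfolding hypergeo_F_def by (intro sums_unique[symmetric] has_sum_imp_sums)
  then show ?thesis using 2 by simp
qed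

section \<open>The contiguous relation\<close>

text \<open>
  The polynomial that Gosper's algorithm produces for the step \<open>a \<rightarrow> a + 2\<close>, with \<open>s\<^sup>2 = 2\<close>
  and argument \<open>3 - 2 s\<close>. Its three coefficients are the solution of the overdetermined linear
  system expressed by \<open>gosper_cert_eq\<close>, which is solvable because \<open>3 - 2 s\<close> is a root of
  \<open>w\<^sup>2 - 6 w + 1\<close>.
\<close>
definition gosper_cert :: "complex \<Rightarrow> complex \<Rightarrow> complex \<Rightarrow> complex" where
  "gosper_cert a s k =
     2 * (s + 1) * k^2 + (- 4 * a - 1 - s - 2 * s * a) * k - (a / 2 + 1 + s * a + s)"

text \<open>
  The telescoping identity at summation index \<open>n + 2\<close> after division by the common
  hypergeometric factor. The two sides differ by a multiple of \<open>s\<^sup>2 - 2\<close>.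
\<close>
lemma gosper_cert_eq:
  fixes a s n :: complex
  assumes s: "s\<^sup>2 = 2"
  shows "(4*a+3)*(4*a+5)*a*(a+1)*(a+1/2)*(a+3/2)
         - (2*a+1)*(2*a+3)*4*(1-a+n)*(2-a+n)*(a+n+5/2)*(a+n+7/2)
         + (2*a+1)*(2*a+3)*(n+2)*(a+n+7/2)*gosper_cert a s (n+2)
      = (2*a+1)*(2*a+3)*(3 - 2 * s)*(n+5/2)*(1-a+n)*gosper_cert a s (n+3)"
proof -
  have "(4*a+3)*(4*a+5)*a*(a+1)/4
         - 4*(1-a+n)*(2-a+n)*(a+n+5/2)*(a+n+7/2)
         + (n+2)*(a+n+7/2)*gosper_cert a s (n+2)
      - (3 - 2 * s)*(n+5/2)*(1-a+n)*gosper_cert a s (n+3)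
      = (s\<^sup>2 - 2) * (2*(n+5/2)*(1-a+n)*(2*(n+3)^2 - (1+2*a)*(n+3) - (a+1)))"
    unfolding gosper_cert_def by (simp add: field_simps power2_eq_square)
  then have *: "(4*a+3)*(4*a+5)*a*(a+1)/4
         - 4*(1-a+n)*(2-a+n)*(a+n+5/2)*(a+n+7/2)
         + (n+2)*(a+n+7/2)*gosper_cert a s (n+2)
      = (3 - 2 * s)*(n+5/2)*(1-a+n)*gosper_cert a s (n+3)"
    using s by simp
  have "(4*a+3)*(4*a+5)*a*(a+1)*(a+1/2)*(a+3/2)
         - (2*a+1)*(2*a+3)*4*(1-a+n)*(2-a+n)*(a+n+5/2)*(a+n+7/2)
         + (2*a+1)*(2*a+3)*(n+2)*(a+n+7/2)*gosper_cert a s (n+2) =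
      (2*a+1)*(2*a+3)*((4*a+3)*(4*a+5)*a*(a+1)/4
         - 4*(1-a+n)*(2-a+n)*(a+n+5/2)*(a+n+7/2)
         + (n+2)*(a+n+7/2)*gosper_cert a s (n+2))"
    by (simp add: field_simps)
  then show ?thesis unfolding * by (simp add: mult_ac)
qed

text \<open>
  The partial sums of the contiguous relation have a closed form, which makes the induction
  immediate from \<open>gosper_cert_eq\<close>. The sums stop at \<open>Suc n\<close>, never at \<open>0\<close>: written
  this way the closed form contains \<open>pochhammer (1 - a) n\<close> with a nonnegative index, and the
  integers \<open>a \<ge> -1\<close>, at which the usual certificate (a rational multiple of the general
  term) has a vanishing denominator, need no separate treatment.
\<close>
lemma contiguous_telescoping:
  fixes a s :: complex
  assumes s: "s\<^sup>2 = 2" and a: "a + 1/2 \<notin> \<int>\<^sub>\<le>\<^sub>0"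
  defines "w \<equiv> 3 - 2 * s"
  shows "(\<Sum>k\<le>Suc n. (4*a+3)*(4*a+5) * hypergeo_term (1/2) (1-(a+2)) ((a+2)+1/2) w k
                     - 4*(2*a+1)*(2*a+3) * hypergeo_term (1/2) (1-a) (a+1/2) w k) =
         (2*a+1)*(2*a+3) * gosper_cert a s (of_nat n + 2) * pochhammer (1/2) (n+2) * pochhammer (1-a) n * w^(n+2)
           / (pochhammer (a+1/2) (n+3) * fact (Suc n))"
    (is "(\<Sum>k\<le>_. ?D k) = ?H n")
proof (induction n)
  have pc: "pochhammer (a+1/2) m \<noteq> 0" for m
    using a pochhammer_eq_0_imp_nonpos_Int by blast
  case 0
  have *: "a + 1/2 \<noteq> 0" "a + 3/2 \<noteq> 0" "a + 5/2 \<noteq> 0"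
    using pc[of 3] by (simp_all add: eval_nat_numeral pochhammer_Suc add.assoc)
  then have **: "2*a+1 \<noteq> 0" "2*a+3 \<noteq> 0" "2*a+5 \<noteq> 0"
    by algebra+
  have D0: "?D 0 = 3"
    by (simp add: hypergeo_term_def algebra_simps)
  have D1: "?D 1 = - ((4*a+3)*(4*a+5)*(a+1)*w/(2*a+5)) - 4 *(2*a+3)*(1-a)*w"
    using ** * by (simp add: hypergeo_term_def divide_simps) algebra
  have y2: "gosper_cert a s 2 = 5 - 17/2*a + 5 * s - 5 * s * a"
    by (simp add: gosper_cert_def algebra_simps power2_eq_square)
  have D01: "3 - ((4*a+3)*(4*a+5)*(a+1)*w/(2*a+5)) - 4 *(2*a+3)*(1-a)*w =
      (5 - 17/2*a + 5 * s - 5 * s * a)*6*w\<^sup>2/(2*a+5)"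
  proof -
    have "3*(2*a+5) - (4*a+3)*(4*a+5)*(a+1)*w - 4 *(2*a+3)*(1-a)*w*(2*a+5)
        = (5 - 17/2*a + 5 * s - 5 * s * a)*6*w\<^sup>2 - 6*(20*(1-a) * s - 40 + 26*a)*(s\<^sup>2 - 2)"
      unfolding w_def by (simp add: field_simps power2_eq_square)
    then have "(3*(2*a+5) - (4*a+3)*(4*a+5)*(a+1)*w - 4 *(2*a+3)*(1-a)*w*(2*a+5)) / (2*a+5)
        = (5 - 17/2*a + 5 * s - 5 * s * a)*6*w\<^sup>2 / (2*a+5)"
      using s by simp
    then show ?thesis
      by (simp only: diff_divide_distrib nonzero_mult_div_cancel_right[OF **(3)])
  qed
  have H0: "?H 0 = gosper_cert a s 2 * 6*w\<^sup>2/(2*a+5)"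
    using ** * by (simp add: eval_nat_numeral pochhammer_Suc divide_simps) algebra
  have "sum f {..Suc 0} = f 0 + f 1" for f :: "nat \<Rightarrow> complex"
    by simp
  then have "(\<Sum>k\<le>Suc 0. ?D k) = ?D 0 + ?D 1" .
  also have "\<dots> = 3 - ((4*a+3)*(4*a+5)*(a+1)*w/(2*a+5)) - 4 *(2*a+3)*(1-a)*w"
    unfolding D0 D1 by simp
  also have "\<dots> = ?H 0"
    unfolding D01 H0 y2 ..
  finally show ?case .
next
  case (Suc n)
  have pc: "pochhammer (a+1/2) m \<noteq> 0" for m
    using a pochhammer_eq_0_imp_nonpos_Int by blast
  define P Q R where "P = pochhammer (1/2::complex) (n+2)" and "Q = pochhammer (1-a) n"
    and "R = pochhammer (a+1/2) (n+3)"
  define N :: complex where "N = of_nat n"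
  \<comment> \<open>All four terms of the step are polynomial multiples of \<open>E\<close>.\<close>
  define E where "E = P * Q * w ^ (n+2) / (R * (a + N + 7/2) * fact (n + 2))"
  have nz: "R \<noteq> 0" "a + N + 5/2 \<noteq> 0" "a + N + 7/2 \<noteq> 0" "a + 1/2 \<noteq> 0" "a + 3/2 \<noteq> 0"
  proof -
    have "a + 1/2 + of_nat j \<noteq> 0" for j
      using pc[of "Suc j"] by (simp add: pochhammer_Suc)
    from this[of "n+2"] this[of "n+3"] this[of 0] this[of 1] pc[of "n+3"]
    show "R \<noteq> 0" "a + N + 5/2 \<noteq> 0" "a + N + 7/2 \<noteq> 0" "a + 1/2 \<noteq> 0" "a + 3/2 \<noteq> 0"
      by (simp_all add: R_def N_def algebra_simps)
  qed
  have N: "N + 1 \<noteq> 0" "N + 2 \<noteq> 0"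
    using of_nat_neq_0[of n, where ?'a = complex] of_nat_neq_0[of "Suc n", where ?'a = complex]
    by (simp_all add: N_def algebra_simps)
  have f: "fact (n + 2) = (N + 2) * (fact (Suc n) :: complex)"
    by (simp add: N_def algebra_simps)
  have R2: "R = pochhammer (a+1/2) (n+2) * (a+N+5/2)"
    by (simp add: R_def N_def eval_nat_numeral pochhammer_Suc algebra_simps)
  have R4: "pochhammer (a+1/2) (n+4) = R * (a+N+7/2)"
    by (simp add: R_def N_def eval_nat_numeral pochhammer_Suc algebra_simps)
  also have "pochhammer (a+1/2) (n+4) = (a+1/2) * (a+3/2) * pochhammer (a+2+1/2) (n+2)"
    using pochhammer_product'[of "a+1/2" 2 "n+2"]
    by (simp add: eval_nat_numeral pochhammer_Suc algebra_simps)
  finally have R5: "R * (a+N+7/2) = (a+1/2) * (a+3/2) * pochhammer (a+2+1/2) (n+2)" ..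
  have Q2: "pochhammer (1-a) (n+2) = Q * (1-a+N) * (2-a+N)"
    by (simp add: Q_def N_def eval_nat_numeral pochhammer_Suc algebra_simps)
  have Q3: "pochhammer (1-(a+2)) (n+2) = a * (a+1) * Q"
    using pochhammer_product'[of "1-(a+2)" 2 n]
    by (simp add: Q_def eval_nat_numeral pochhammer_Suc algebra_simps)
  have P3: "pochhammer (1/2) (Suc n+2) = P * (N + 5/2)"
    by (simp add: P_def N_def eval_nat_numeral pochhammer_Suc algebra_simps)
  have t0: "hypergeo_term (1/2) (1-a) (a+1/2) w (n+2) =
      E * ((1-a+N)*(2-a+N)*(a+N+5/2)*(a+N+7/2))"
    unfolding hypergeo_term_def Q2 E_def P_def[symmetric] R2 using nz
    by (simp add: pochhammer_fact[symmetric])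
  have p5: "pochhammer (a+2+1/2) (n+2) \<noteq> 0"
    using R5 nz by auto
  have t2: "hypergeo_term (1/2) (1-(a+2)) (a+2+1/2) w (n+2) =
      E * (a*(a+1)*(a+1/2)*(a+3/2))"
    unfolding hypergeo_term_def Q3 E_def P_def[symmetric] R5 using nz p5
    by (simp add: pochhammer_fact[symmetric] power_add)
  have H0: "?H n = E * ((2*a+1)*(2*a+3)*(N+2)*(a+N+7/2)*gosper_cert a s (N+2))"
    unfolding E_def P_def[symmetric] Q_def[symmetric] R_def[symmetric] N_def[symmetric] f
    using nz N by (simp add: divide_simps)
  have H1: "?H (Suc n) = E * ((2*a+1)*(2*a+3)*w*(N+5/2)*(1-a+N)*gosper_cert a s (N+3))"
  proof -
    have "pochhammer (a+1/2) (Suc n + 3) = R * (a+N+7/2)"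
      using R4 by (simp add: eval_nat_numeral)
    moreover have "pochhammer (1-a) (Suc n) = Q * (1-a+N)"
      by (simp add: Q_def N_def pochhammer_Suc)
    moreover have "of_nat (Suc n) + 2 = N + 3"
      by (simp add: N_def)
    moreover have "fact (Suc (Suc n)) = (fact (n + 2) :: complex)"
      by simp
    ultimately show ?thesis
      unfolding E_def P3 by (simp only: power_Suc add_Suc times_divide_eq_left times_divide_eq_right mult_ac)
  qed
  have "(\<Sum>k\<le>Suc (Suc n). ?D k) = ?H n + ?D (n+2)"
    using Suc.IH by (simp del: power_Suc)
  also have "\<dots> = ?H (Suc n)"
    unfolding H0 H1 t0 t2 using gosper_cert_eq[OF s, of a N] unfolding w_def by algebra
  finally show ?case .
qed

text \<open>
  The telescoped partial sums are, up to a constant, the terms of a convergent hypergeometric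
  series times a factor of linear growth, so they tend to \<open>0\<close>.
\<close>
lemma contiguous_relation:
  fixes a s :: complex
  assumes s: "s\<^sup>2 = 2" and ns: "norm (3 - 2 * s) < 1" and a: "a + 1/2 \<notin> \<int>\<^sub>\<le>\<^sub>0"
  shows "(4*a+3)*(4*a+5) * hypergeo_F (1/2) (1-(a+2)) ((a+2)+1/2) (3 - 2 * s) =
         4*(2*a+1)*(2*a+3) * hypergeo_F (1/2) (1-a) (a+1/2) (3 - 2 * s)"
proof -
  define w where "w = 3 - 2 * s"
  have w: "norm w < 1" using ns by (simp add: w_def)
  define H where "H n = (2*a+1)*(2*a+3) * gosper_cert a s (of_nat n + 2) * pochhammer (1/2) (n+2)
           * pochhammer (1-a) n * w^(n+2) / (pochhammer (a+1/2) (n+3) * fact (Suc n))" for n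
  define D where "D k = (4*a+3)*(4*a+5) * hypergeo_term (1/2) (1-(a+2)) ((a+2)+1/2) w k
                     - 4*(2*a+1)*(2*a+3) * hypergeo_term (1/2) (1-a) (a+1/2) w k" for k
  have "D sums ((4*a+3)*(4*a+5) * hypergeo_F (1/2) (1-(a+2)) ((a+2)+1/2) w
                - 4*(2*a+1)*(2*a+3) * hypergeo_F (1/2) (1-a) (a+1/2) w)"
    unfolding D_def hypergeo_F_def
    by (intro sums_diff sums_mult summable_sums summable_hypergeo_term w)
  then have "(\<lambda>n. \<Sum>k\<le>Suc n. D k) \<longlonglongrightarrow>
      (4*a+3)*(4*a+5) * hypergeo_F (1/2) (1-(a+2)) ((a+2)+1/2) w
                - 4*(2*a+1)*(2*a+3) * hypergeo_F (1/2) (1-a) (a+1/2) w"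
    unfolding sums_def_le by (rule LIMSEQ_Suc)
  moreover have "(\<Sum>k\<le>Suc n. D k) = H n" for n
    unfolding D_def H_def w_def by (rule contiguous_telescoping[OF s a])
  moreover have "H \<longlonglongrightarrow> 0"
  proof -
    define K where "K = (2*a+1)*(2*a+3) * w^2 * pochhammer (1/2) 2 / pochhammer (a+1/2) 3"
    define h where "h n = hypergeo_term (5/2) (1-a) (a+7/2) w n" for n
    define A B C where "A = 2*(s+1)" and "B = 4*(s+1) + (-4*a-1-s-2 * s * a)"
      and "C = 2*(s+1) + (-4*a-1-s-2 * s * a) - (a/2+1+s*a+s)"
    have h0: "h \<longlonglongrightarrow> 0"
      unfolding h_def by (intro summable_LIMSEQ_zero summable_hypergeo_term w)
    have h1: "(\<lambda>n. of_nat n * h n) \<longlonglongrightarrow> 0"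
      unfolding h_def by (rule hypergeo_term_times_n_tendsto_0[OF w])
    have h2: "(\<lambda>n. h n / of_nat (Suc n)) \<longlonglongrightarrow> 0"
      using tendsto_mult[OF h0 LIMSEQ_Suc[OF lim_inverse_n]]
      by (simp add: divide_inverse del: of_nat_Suc)
    have "(\<lambda>n. K * (A * (of_nat n * h n) + (A + B) * h n + C * (h n / of_nat (Suc n))))
            \<longlonglongrightarrow> K * (A * 0 + (A + B) * 0 + C * 0)"
      by (intro tendsto_intros h0 h1 h2)
    moreover have "H = (\<lambda>n. K * (A * (of_nat n * h n) + (A + B) * h n + C * (h n / of_nat (Suc n))))"
    proof
      fix n
      have y: "gosper_cert a s (of_nat n + 2) = of_nat (Suc n) * (A * of_nat n + (A + B) + C / of_nat (Suc n))"
        using of_nat_neq_0[of n, where ?'a = complex]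
        by (simp add: gosper_cert_def A_def B_def C_def divide_simps power2_eq_square del: of_nat_Suc)
          (simp add: algebra_simps)
      have "H n = K * h n * (gosper_cert a s (of_nat n + 2) / of_nat (Suc n))"
        unfolding H_def K_def h_def hypergeo_term_def
        using pochhammer_product'[of "1/2::complex" 2 n] pochhammer_product'[of "a+1/2" 3 n]
        by (simp add: add_ac pochhammer_fact[symmetric] power2_eq_square mult_ac del: of_nat_Suc)
      then show "H n = K * (A * (of_nat n * h n) + (A + B) * h n + C * (h n / of_nat (Suc n)))"
        unfolding y using of_nat_neq_0[of n, where ?'a = complex]
        by (simp add: algebra_simps add_divide_distrib del: of_nat_Suc)
    qed
    ultimately show ?thesis by simp
  qed
  ultimately have "(4*a+3)*(4*a+5) * hypergeo_F (1/2) (1-(a+2)) ((a+2)+1/2) w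
                - 4*(2*a+1)*(2*a+3) * hypergeo_F (1/2) (1-a) (a+1/2) w = 0"
    by (simp only: LIMSEQ_unique)
  then show ?thesis unfolding w_def by simp
qed

lemma contiguous_relation_iterated:
  fixes a s :: complex
  assumes s: "s\<^sup>2 = 2" and ns: "norm (3 - 2 * s) < 1" and a: "a + 1/2 \<notin> \<int>\<^sub>\<le>\<^sub>0"
  shows "pochhammer (a/2 + 1/4) n * pochhammer (a/2 + 3/4) n
           * hypergeo_F (1/2) (1 - a) (a + 1/2) (3 - 2 * s) =
         pochhammer (a/2 + 3/8) n * pochhammer (a/2 + 5/8) n
           * hypergeo_F (1/2) (1 - (a + 2 * of_nat n)) (a + 2 * of_nat n + 1/2) (3 - 2 * s)"
proof (induction n)
  case (Suc n)
  define b where "b = a + 2 * of_nat n"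
  define \<phi> where "\<phi> b = hypergeo_F (1/2) (1-b) (b+1/2) (3 - 2 * s)" for b
  have "b + 1/2 \<notin> \<int>\<^sub>\<le>\<^sub>0"
  proof
    assume "b + 1/2 \<in> \<int>\<^sub>\<le>\<^sub>0"
    then have "b + 1/2 - of_nat (2 * n) \<in> \<int>\<^sub>\<le>\<^sub>0"
      by (rule nonpos_Ints_diff_Nats) simp
    with a show False by (simp add: b_def)
  qed
  from contiguous_relation[OF s ns this]
  have "(b/2 + 3/8) * (b/2 + 5/8) * \<phi> (b + 2) = (b/2 + 1/4) * (b/2 + 3/4) * \<phi> b"
    by (simp add: \<phi>_def field_simps)
  moreover have "b/2 + c = a/2 + c + of_nat n" for c
    by (simp add: b_def)
  ultimately have step: "(a/2 + 3/8 + of_nat n) * (a/2 + 5/8 + of_nat n) * \<phi> (b + 2) =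
      (a/2 + 1/4 + of_nat n) * (a/2 + 3/4 + of_nat n) * \<phi> b"
    by simp
  have "pochhammer (a/2 + 1/4) (Suc n) * pochhammer (a/2 + 3/4) (Suc n) * \<phi> a =
      (a/2 + 1/4 + of_nat n) * (a/2 + 3/4 + of_nat n) *
      (pochhammer (a/2 + 1/4) n * pochhammer (a/2 + 3/4) n * \<phi> a)"
    by (simp add: pochhammer_Suc mult_ac)
  also have "pochhammer (a/2 + 1/4) n * pochhammer (a/2 + 3/4) n * \<phi> a =
         pochhammer (a/2 + 3/8) n * pochhammer (a/2 + 5/8) n * \<phi> b"
    using Suc.IH by (simp add: \<phi>_def b_def)
  also have "(a/2 + 1/4 + of_nat n) * (a/2 + 3/4 + of_nat n) *
      (pochhammer (a/2 + 3/8) n * pochhammer (a/2 + 5/8) n * \<phi> b) =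
      pochhammer (a/2 + 3/8) n * pochhammer (a/2 + 5/8) n *
      ((a/2 + 1/4 + of_nat n) * (a/2 + 3/4 + of_nat n) * \<phi> b)"
    by (simp only: mult_ac)
  also have "\<dots> = pochhammer (a/2 + 3/8) (Suc n) * pochhammer (a/2 + 5/8) (Suc n) * \<phi> (b + 2)"
    unfolding step[symmetric] by (simp only: pochhammer_Suc mult_ac)
  finally have "pochhammer (a/2 + 1/4) (Suc n) * pochhammer (a/2 + 3/4) (Suc n) * \<phi> a =
      pochhammer (a/2 + 3/8) (Suc n) * pochhammer (a/2 + 5/8) (Suc n) * \<phi> (b + 2)" .
  moreover have "b + 2 = a + 2 * of_nat (Suc n)"
    by (simp add: b_def)
  ultimately show ?case
    by (simp only: \<phi>_def)
qed simp

section \<open>Behaviour for large parameters\<close>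

lemma tendsto_pochhammer_quotient:
  fixes u v :: complex
  shows "(\<lambda>n. pochhammer (u - 2 * of_nat n) k / pochhammer (v + 2 * of_nat n) k) \<longlonglongrightarrow> (-1) ^ k"
proof (induction k)
  case (Suc k)
  have "(\<lambda>n. ((u + of_nat k) / of_nat n - 2) / ((v + of_nat k) / of_nat n + 2)) \<longlonglongrightarrow> (0 - 2) / (0 + 2)"
    by (intro tendsto_intros lim_const_over_n) auto
  moreover have "eventually (\<lambda>n. ((u + of_nat k) / of_nat n - 2) / ((v + of_nat k) / of_nat n + 2) =
      (u - 2 * of_nat n + of_nat k) / (v + 2 * of_nat n + of_nat k)) sequentially"
    using eventually_gt_at_top[of 0]
  proof eventually_elim
    case (elim n)
    then have "(u + of_nat k) / of_nat n - 2 = (u - 2 * of_nat n + of_nat k) / of_nat n"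
      "(v + of_nat k) / of_nat n + 2 = (v + 2 * of_nat n + of_nat k) / of_nat n"
      by (simp_all add: field_simps)
    then show ?case using elim by simp
  qed
  ultimately have "(\<lambda>n. (u - 2 * of_nat n + of_nat k) / (v + 2 * of_nat n + of_nat k)) \<longlonglongrightarrow> -1"
    by (auto dest: Lim_transform_eventually)
  from tendsto_mult[OF Suc.IH this] show ?case
    by (simp add: pochhammer_Suc)
qed simp

lemma norm_pochhammer_mono:
  fixes z z' :: complex
  assumes "\<And>j. norm (z + of_nat j) \<le> norm (z' + of_nat j)"
  shows "norm (pochhammer z k) \<le> norm (pochhammer z' k)"
  by (induction k) (simp_all add: pochhammer_Suc norm_mult mult_mono assms)

text \<open>
  In the limit the quotient of the Pochhammer symbols containing \<open>a\<close> becomes \<open>(-1) ^ k\<close>, which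
  leaves the binomial series. Tannery's theorem applies because that quotient has norm at most
  \<open>1\<close> once the real part of \<open>a + 2 n\<close> is large: then \<open>1 - (a + 2 n) + j\<close> and
  \<open>a + 2 n + 1/2 + j\<close> have opposite imaginary parts, and the real part of the second is the
  larger one in absolute value.
\<close>
lemma hypergeo_F_tendsto_binomial:
  assumes x: "norm x < 1"
  shows "(\<lambda>n. hypergeo_F d (1 - (a + 2 * of_nat n)) (a + 2 * of_nat n + 1/2) x)
           \<longlonglongrightarrow> (1 + x) powr (-d)"
proof -
  define f where "f k n = hypergeo_term d (1 - (a + 2 * of_nat n)) (a + 2 * of_nat n + 1/2) x k"
    for k n
  define M where "M k = norm (hypergeo_term d 1 1 x k)" for k
  have lim: "f k \<longlonglongrightarrow> pochhammer d k / fact k * (-x) ^ k" for k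
  proof -
    have "(\<lambda>n. pochhammer d k / fact k * x ^ k *
        (pochhammer (1 - a - 2 * of_nat n) k / pochhammer (a + 1/2 + 2 * of_nat n) k))
        \<longlonglongrightarrow> pochhammer d k / fact k * x ^ k * (-1) ^ k"
      by (intro tendsto_intros tendsto_pochhammer_quotient)
    then show ?thesis
      by (simp add: f_def[abs_def] hypergeo_term_def pochhammer_fact[symmetric] algebra_simps
            power_minus[of x])
  qed
  have bound: "norm (f k n) \<le> M k" if n: "n \<ge> nat \<lceil>1 - Re a\<rceil>" for k n
  proof -
    have "real n \<ge> 1 - Re a"
      using n by linarith
    then have "norm (1 - (a + 2 * of_nat n) + of_nat j) \<le> norm (a + 2 * of_nat n + 1/2 + of_nat j)"
      for j
      unfolding cmod_def by (intro real_sqrt_le_mono add_mono) (auto simp: abs_le_square_iff[symmetric])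
    then have "norm (pochhammer (1 - (a + 2 * of_nat n)) k) \<le> norm (pochhammer (a + 2 * of_nat n + 1/2) k)"
      by (rule norm_pochhammer_mono)
    then have *: "norm (pochhammer (1 - (a + 2 * of_nat n)) k / pochhammer (a + 2 * of_nat n + 1/2) k) \<le> 1"
      by (simp add: norm_divide divide_le_eq_1)
    have "norm (f k n) = M k * norm (pochhammer (1 - (a + 2 * of_nat n)) k / pochhammer (a + 2 * of_nat n + 1/2) k)"
      by (simp add: f_def M_def hypergeo_term_def norm_mult norm_divide pochhammer_fact[symmetric]
            mult_ac)
    also have "\<dots> \<le> M k * 1"
      by (intro mult_left_mono *) (simp add: M_def)
    finally show ?thesis by simp
  qed
  have "eventually (\<lambda>(k, n). norm (f k n) \<le> M k) (at_top \<times>\<^sub>F sequentially)"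
    unfolding eventually_prod_sequentially
    by (intro exI[of _ "nat \<lceil>1 - Re a\<rceil>"]) (auto intro: bound)
  moreover have "summable M"
    unfolding M_def by (rule norm_summable_hypergeo_term[OF x])
  ultimately have "(\<lambda>n. \<Sum>k. f k n) \<longlonglongrightarrow> (\<Sum>k. pochhammer d k / fact k * (-x) ^ k)"
    using tannerys_theorem[OF lim] by force
  moreover have "(\<Sum>k. pochhammer d k / fact k * (-x) ^ k) = (1 + x) powr (-d)"
    using has_sum_imp_sums[OF binomial_series_pochhammer[of "-x" d]] x by (simp add: sums_iff)
  ultimately show ?thesis
    by (simp add: f_def hypergeo_F_def)
qed

section \<open>Evaluation\<close>

text \<open>
  In the iterated relation the Pochhammer symbols are, up to powers of \<open>n\<close>, the approximants
  \<open>rGamma_series\<close>. The powers of \<open>n\<close> cancel since both pairs of parameters have the sum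
  \<open>a + 1\<close>.
\<close>
lemma hypergeo_F_half_value:
  fixes a s :: complex
  assumes s: "s\<^sup>2 = 2" and ns: "norm (3 - 2 * s) < 1" and a: "a + 1/2 \<notin> \<int>\<^sub>\<le>\<^sub>0"
  shows "rGamma (a/2 + 1/4) * rGamma (a/2 + 3/4) * hypergeo_F (1/2) (1 - a) (a + 1/2) (3 - 2 * s) =
         rGamma (a/2 + 3/8) * rGamma (a/2 + 5/8) * (4 - 2 * s) powr (-1/2)"
proof -
  define \<phi> where "\<phi> b = hypergeo_F (1/2) (1-b) (b+1/2) (3 - 2 * s)" for b
  have eq: "rGamma_series (a/2 + 1/4) n * rGamma_series (a/2 + 3/4) n * \<phi> a =
        rGamma_series (a/2 + 3/8) n * rGamma_series (a/2 + 5/8) n * \<phi> (a + 2 * of_nat (Suc n))" for n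
  proof -
    define L where "L = complex_of_real (ln (of_nat n))"
    have e: "exp ((a/2 + 1/4) * L) * exp ((a/2 + 3/4) * L) = exp ((a/2 + 3/8) * L) * exp ((a/2 + 5/8) * L)"
      by (simp add: mult_exp_exp algebra_simps)
    have "rGamma_series (a/2 + 1/4) n * rGamma_series (a/2 + 3/4) n * \<phi> a =
       (pochhammer (a/2 + 1/4) (Suc n) * pochhammer (a/2 + 3/4) (Suc n) * \<phi> a) /
         (fact n ^ 2 * (exp ((a/2 + 1/4) * L) * exp ((a/2 + 3/4) * L)))"
      by (simp add: rGamma_series_def L_def power2_eq_square)
    also have "pochhammer (a/2 + 1/4) (Suc n) * pochhammer (a/2 + 3/4) (Suc n) * \<phi> a =
       pochhammer (a/2 + 3/8) (Suc n) * pochhammer (a/2 + 5/8) (Suc n) * \<phi> (a + 2 * of_nat (Suc n))"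
      unfolding \<phi>_def by (rule contiguous_relation_iterated[OF s ns a])
    also have "\<dots> / (fact n ^ 2 * (exp ((a/2 + 1/4) * L) * exp ((a/2 + 3/4) * L))) =
       rGamma_series (a/2 + 3/8) n * rGamma_series (a/2 + 5/8) n * \<phi> (a + 2 * of_nat (Suc n))"
      unfolding e by (simp add: rGamma_series_def L_def power2_eq_square)
    finally show ?thesis .
  qed
  have "(\<lambda>n. \<phi> (a + 2 * of_nat n)) \<longlonglongrightarrow> (1 + (3 - 2 * s)) powr (-(1/2))"
    unfolding \<phi>_def by (rule hypergeo_F_tendsto_binomial[OF ns])
  then have "(\<lambda>n. \<phi> (a + 2 * of_nat (Suc n))) \<longlonglongrightarrow> (4 - 2 * s) powr (-1/2)"
    by (intro LIMSEQ_Suc) simp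
  then have "(\<lambda>n. rGamma_series (a/2 + 3/8) n * rGamma_series (a/2 + 5/8) n * \<phi> (a + 2 * of_nat (Suc n)))
     \<longlonglongrightarrow> rGamma (a/2 + 3/8) * rGamma (a/2 + 5/8) * (4 - 2 * s) powr (-1/2)"
    by (intro tendsto_intros)
  moreover have "(\<lambda>n. rGamma_series (a/2 + 1/4) n * rGamma_series (a/2 + 3/4) n * \<phi> a)
     \<longlonglongrightarrow> rGamma (a/2 + 1/4) * rGamma (a/2 + 3/4) * \<phi> a"
    by (intro tendsto_intros)
  ultimately have "rGamma (a/2 + 1/4) * rGamma (a/2 + 3/4) * \<phi> a =
      rGamma (a/2 + 3/8) * rGamma (a/2 + 5/8) * (4 - 2 * s) powr (-1/2)"
    unfolding eq by (rule LIMSEQ_unique[rotated])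
  then show ?thesis
    by (simp only: \<phi>_def)
qed

theorem mainTheorem15:
  fixes a :: complex
  assumes "a + 1/2 \<notin> \<int>\<^sub>\<le>\<^sub>0"
  shows "hypergeo_F a (1 - a) (a + 1/2) (complex_of_real (1/2 - 1/2 * sqrt 2)) =
           2 powr (3/4 - 2 * a) * complex_of_real (sqrt 2 - 1) powr (1/2 - a)
           * complex_of_real (sqrt pi) * Gamma (a + 1/2)
           * rGamma (1/2 * a + 3/8) * rGamma (1/2 * a + 5/8)"
proof -
  define s where "s = complex_of_real (sqrt 2)"
  define x where "x = complex_of_real (1/2 - 1/2 * sqrt 2)"
  define l where "l = ln (sqrt 2 - 1)"
  have b: "1.4 < sqrt 2" "sqrt 2 < 1.5"
    by (rule real_less_rsqrt real_less_lsqrt; simp add: power2_eq_square)+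
  have s2: "s\<^sup>2 = 2"
    by (simp add: s_def flip: of_real_power)
  have "3 - 2 * s = of_real (3 - 2 * sqrt 2)"
    by (simp add: s_def)
  then have ns: "norm (3 - 2 * s) < 1"
    using b by (simp only: norm_of_real)
  have nx: "norm x < 1/2"
    unfolding x_def norm_of_real using b by simp
  have x1: "x - 1 \<noteq> 0"
    using nx by auto
  have xs: "x = 1/2 - 1/2 * s"
    by (simp add: x_def s_def)
  have "x = (3 - 2 * s) * (x - 1)"
    unfolding xs using s2 by (simp add: field_simps power2_eq_square)
  then have w: "x / (x - 1) = 3 - 2 * s"
    using x1 by (simp add: field_simps)
  have ln2: "ln (1/2 * (sqrt 2 + 1)) = - l - ln 2"
  proof -
    have "(sqrt 2 + 1) * (sqrt 2 - 1) = 1"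
      by (simp add: algebra_simps)
    then have "1/2 * (sqrt 2 + 1) = inverse ((sqrt 2 - 1) * 2)"
      using b by (simp add: field_simps)
    moreover have "ln (inverse (t * 2)) = - ln t - ln 2" if "t > 0" for t :: real
      using that by (simp add: ln_inverse ln_mult del: inverse_mult_distrib)
    ultimately show ?thesis
      using b by (simp only: l_def)
  qed
  have ln4: "ln (4 - 2 * sqrt 2) = 3/2 * ln 2 + l"
  proof -
    have "4 - 2 * sqrt 2 = 2 * (sqrt 2 * (sqrt 2 - 1))"
      by (simp add: algebra_simps)
    then show ?thesis
      using b by (simp add: ln_mult l_def ln_sqrt)
  qed
  \<comment> \<open>All bases are positive reals, so every power becomes an exponential in \<open>ln 2\<close> and \<open>l\<close>.\<close>
  have p: "of_real r powr z = exp (z * of_real (ln r))" if "r > 0" for r :: real and z :: complex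
    using that by (simp add: powr_def Ln_of_real)
  have p1: "(1 - x) powr (-(1 - a)) = exp ((1 - a) * of_real (l + ln 2))"
  proof -
    have "1 - x = of_real (1/2 * (sqrt 2 + 1))"
      by (simp add: x_def algebra_simps)
    moreover have "0 < 1/2 * (sqrt 2 + 1)"
      using b by simp
    ultimately have "(1 - x) powr (-(1 - a)) = exp (-(1 - a) * of_real (- l - ln 2))"
      by (simp only: p ln2)
    then show ?thesis
      by (simp add: algebra_simps)
  qed
  have p2: "(4 - 2 * s) powr (-1/2) = exp (-1/2 * of_real (3/2 * ln 2 + l))"
  proof -
    have "4 - 2 * s = of_real (4 - 2 * sqrt 2)"
      by (simp add: s_def)
    then show ?thesis
      using b by (simp only: p ln4)
  qed
  have p3: "of_real (sqrt 2 - 1) powr (1/2 - a) = exp ((1/2 - a) * of_real l)"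
    using b by (simp only: p l_def)
  have p4: "2 powr z = exp (z * of_real (ln 2))" for z :: complex
    using p[of 2] by simp
  have np: "a/2 + 1/4 \<notin> \<int>\<^sub>\<le>\<^sub>0" "a/2 + 1/4 + 1/2 \<notin> \<int>\<^sub>\<le>\<^sub>0"
  proof -
    show "a/2 + 1/4 \<notin> \<int>\<^sub>\<le>\<^sub>0"
      using nonpos_Ints_add[of "a/2 + 1/4" "a/2 + 1/4"] assms by auto
    have "a + 1/2 + 1 \<notin> \<int>\<^sub>\<le>\<^sub>0"
      using assms plus_one_in_nonpos_Ints_imp by blast
    then show "a/2 + 1/4 + 1/2 \<notin> \<int>\<^sub>\<le>\<^sub>0"
      using nonpos_Ints_add[of "a/2 + 1/4 + 1/2" "a/2 + 1/4 + 1/2"] by (auto simp: algebra_simps)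
  qed
  have dup: "Gamma (a/2 + 1/4) * Gamma (a/2 + 3/4) =
             exp ((1/2 - a) * of_real (ln 2)) * of_real (sqrt pi) * Gamma (a + 1/2)"
    using Gamma_legendre_duplication[OF np] by (simp add: algebra_simps)
  have "hypergeo_F (1/2) (1 - a) (a + 1/2) (3 - 2 * s) = Gamma (a/2 + 1/4) * Gamma (a/2 + 3/4) *
    (rGamma (a/2 + 1/4) * rGamma (a/2 + 3/4) * hypergeo_F (1/2) (1 - a) (a + 1/2) (3 - 2 * s))"
  proof -
    have *: "Gamma z * rGamma z = 1" if "z \<notin> \<int>\<^sub>\<le>\<^sub>0" for z :: complex
      using that by (simp add: rGamma_inverse_Gamma Gamma_eq_zero_iff)
    have "a/2 + 1/4 + 1/2 = a/2 + 3/4"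
      by simp
    then have r2: "Gamma (a/2 + 3/4) * rGamma (a/2 + 3/4) = 1"
      using *[OF np(2)] by (simp only:)
    have regroup: "G * G' * (r * r' * h) = (G * r) * (G' * r') * h" for G G' r r' h :: complex
      by (simp only: mult_ac)
    show ?thesis
      by (simp only: regroup *[OF np(1)] r2 mult_1_left)
  qed
  also have "\<dots> = exp ((1/2 - a) * of_real (ln 2)) * of_real (sqrt pi) * Gamma (a + 1/2) *
       (rGamma (a/2 + 3/8) * rGamma (a/2 + 5/8) * exp (-1/2 * of_real (3/2 * ln 2 + l)))"
    unfolding hypergeo_F_half_value[OF s2 ns assms] dup p2 ..
  finally have v: "hypergeo_F (1/2) (1 - a) (a + 1/2) (3 - 2 * s) = \<dots>" .
  have "hypergeo_F a (1 - a) (a + 1/2) x =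
      (1 - x) powr (-(1 - a)) * hypergeo_F (1/2) (1 - a) (a + 1/2) (3 - 2 * s)"
    using pfaff_transformation[OF nx assms, of a "1 - a"] by (simp add: w)
  also have "\<dots> = (exp ((1 - a) * of_real (l + ln 2)) * exp ((1/2 - a) * of_real (ln 2))
       * exp (-1/2 * of_real (3/2 * ln 2 + l))) * of_real (sqrt pi) * Gamma (a + 1/2)
       * rGamma (a/2 + 3/8) * rGamma (a/2 + 5/8)"
    unfolding v p1 by (simp add: mult_ac)
  also have "exp ((1 - a) * of_real (l + ln 2)) * exp ((1/2 - a) * of_real (ln 2))
       * exp (-1/2 * of_real (3/2 * ln 2 + l)) =
       exp ((3/4 - 2 * a) * of_real (ln 2)) * exp ((1/2 - a) * of_real l)"
    unfolding mult_exp_exp by (rule arg_cong[of _ _ exp]) (simp add: algebra_simps)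
  finally show ?thesis
    unfolding x_def p3 p4 by simp
qed

end
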